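(* Let $l\in\mathbb{N}_0$ and $n\in\mathbb{Z}$. Then there is a constant $C_n>0$ (independent of $t$) such that $$|\delta_{right}^lG(t,n)|\le\frac{C_n}{t^{[(l+1)/2]+1/2}},\qquad t>0.$$
   Context: $G(t,n)=e^{-2t}I_n(2t)$ for $t>0$, $n\in\mathbb{Z}$, is the discrete heat kernel, where $I_n(t)=\sum_{m=0}^\infty\frac{1}{m!\,\Gamma(m+n+1)}(t/2)^{2m+n}$ for $n\in\mathbb{N}_0$ and $I_{-n}=I_n$. $\delta_{right}f(n)=f(n)-f(n+1)$ acts in the variable $n$, $\delta_{right}^l$ is its $l$-th iterate, and $[\cdot]$ is the integer part. $l$ and $n$ are fixed, so the constant may depend on both. *)

theory Defs
  imports "HOL-Analysis.Analysis"
begin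

definition bessel_I_nat :: "nat \<Rightarrow> real \<Rightarrow> real" where
  "bessel_I_nat n t =
     (\<Sum>m. 1 / (fact m * Gamma (real m + real n + 1)) * (t / 2) ^ (2 * m + n))"

text \<open>Modified Bessel function of the first kind of integer order, extended to
  negative orders by the symmetry \<open>I\<^sub>-\<^sub>n = I\<^sub>n\<close>.\<close>

definition bessel_I :: "int \<Rightarrow> real \<Rightarrow> real" where
  "bessel_I n t = bessel_I_nat (nat \<bar>n\<bar>) t"

definition heat_kernel :: "real \<Rightarrow> int \<Rightarrow> real" where
  "heat_kernel t n = exp (- 2 * t) * bessel_I n (2 * t)"

definition delta_right :: "(int \<Rightarrow> real) \<Rightarrow> int \<Rightarrow> real" where
  "delta_right f n = f n - f (n + 1)"

end

theory Submission
  imports Defs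
begin

text \<open>
  The heat kernel is a Fourier coefficient. Multiplying the generating function
  \<open>exp (t * (z + 1 / z))\<close> of the Bessel functions by \<open>exp (- 2 * t)\<close> and restricting it to
  \<open>z = cis x\<close> gives \<open>exp (- t * q x)\<close>, where \<open>q x = 2 - 2 * cos x = \<bar>1 - cis x\<bar>\<^sup>2\<close>. Hence
  \<open>2 * pi * heat_kernel t n\<close> is the integral of \<open>exp (- t * q x) * Re (cis (n * x))\<close> over
  \<open>{-pi..pi}\<close>, and each difference \<open>delta_right\<close> multiplies \<open>cis (n * x)\<close> by the
  symbol \<open>1 - cis x\<close> (\<open>delta_right_heat_kernel_integral\<close>).

  Let \<open>k = (l + 1) div 2\<close>. The point is that the real part of \<open>(1 - cis x) ^ l * cis (n * x)\<close> is
  \<open>O(q ^ k)\<close> with a constant that may depend on \<open>n\<close> (\<open>abs_Re_difference_symbol_le\<close>). For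
  even \<open>l\<close> this is just its modulus. For odd \<open>l\<close> the modulus is only \<open>q powr (l / 2)\<close>, which falls
  short by a factor \<open>sqrt q\<close>; this factor is gained because the leading term \<open>(- \<i> * x) ^ l\<close> of
  the product at \<open>x = 0\<close> is imaginary, so that it contributes nothing to the real part.

  What remains is the decay of the integral of \<open>q ^ k * exp (- t * q)\<close>. Writing
  \<open>q ^ k = (t * q) ^ k / t ^ k\<close> extracts the factor \<open>1 / t ^ k\<close>. The function
  \<open>y ^ k * exp (- y)\<close> of \<open>y = t * q\<close> is dominated by a multiple of \<open>1 / (1 + y)\<close>, and since
  \<open>q x \<ge> x\<^sup>2 / 4\<close> on \<open>{-pi..pi}\<close>, the last factor \<open>1 / sqrt t\<close> comes from an integral of
  arctangent type.
\<close>

section \<open>Integral representation of the Bessel functions\<close>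

text \<open>
  The exponential series converges uniformly on the compact range of \<open>u\<close>, so it may be
  integrated term by term.
\<close>

lemma integral_exp_mult_sums:
  fixes u g :: "real \<Rightarrow> 'a::{real_normed_field,banach}"
  assumes u: "continuous_on {a..b} u" and g: "continuous_on {a..b} g"
  shows "(\<lambda>m. integral {a..b} (\<lambda>x. u x ^ m / fact m * g x)) sums
    integral {a..b} (\<lambda>x. exp (u x) * g x)"
proof -
  obtain B where B: "\<And>x. x \<in> {a..b} \<Longrightarrow> norm (u x) \<le> B"
    using compact_imp_bounded[OF compact_continuous_image[OF u compact_Icc]]
    unfolding bounded_iff by blast
  obtain D where D: "\<And>x. x \<in> {a..b} \<Longrightarrow> norm (g x) \<le> D"
    using compact_imp_bounded[OF compact_continuous_image[OF g compact_Icc]]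
    unfolding bounded_iff by blast
  have le: "norm (u x ^ m / fact m * g x) \<le> B ^ m / fact m * D" if "x \<in> {a..b}" for x m
    unfolding norm_mult norm_divide norm_power norm_fact
    using B[OF that] D[OF that] order_trans[OF norm_ge_zero B[OF that]]
    by (intro mult_mono divide_right_mono power_mono) (auto intro!: divide_nonneg_pos)
  have "summable (\<lambda>m. B ^ m / fact m * D)"
    using summable_exp[of B] by (intro summable_mult2) (simp add: field_simps)
  with le have "uniform_limit {a..b} (\<lambda>N x. \<Sum>m<N. u x ^ m / fact m * g x)
      (\<lambda>x. \<Sum>m. u x ^ m / fact m * g x) sequentially"
    by (rule Weierstrass_m_test)
  also have "(\<lambda>x. \<Sum>m. u x ^ m / fact m * g x) = (\<lambda>x. exp (u x) * g x)"
  proof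
    fix x
    have "(\<lambda>m. u x ^ m / fact m * g x) sums (exp (u x) * g x)"
      using sums_mult2[OF exp_converges[of "u x"], of "g x"]
      by (simp add: scaleR_conv_of_real divide_inverse mult_ac)
    then show "(\<Sum>m. u x ^ m / fact m * g x) = exp (u x) * g x"
      by (simp add: sums_iff)
  qed
  finally have lim: "uniform_limit {a..b} (\<lambda>N x. \<Sum>m<N. u x ^ m / fact m * g x)
      (\<lambda>x. exp (u x) * g x) sequentially" .
  have c: "continuous_on {a..b} (\<lambda>x. u x ^ m / fact m * g x)" for m
    by (intro continuous_intros u g) auto
  obtain I J where IJ: "\<And>N. ((\<lambda>x. \<Sum>m<N. u x ^ m / fact m * g x) has_integral I N) {a..b}"
      "((\<lambda>x. exp (u x) * g x) has_integral J) {a..b}" "I \<longlonglongrightarrow> J"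
    by (rule uniform_limit_integral[OF lim]) (auto intro!: continuous_intros u g)
  have "I N = (\<Sum>m<N. integral {a..b} (\<lambda>x. u x ^ m / fact m * g x))" for N
    by (rule has_integral_unique[OF IJ(1)])
       (intro has_integral_sum integrable_integral integrable_continuous_interval c finite_lessThan)
  then have "I = (\<lambda>N. \<Sum>m<N. integral {a..b} (\<lambda>x. u x ^ m / fact m * g x))" ..
  with IJ(3) integral_unique[OF IJ(2)] show ?thesis
    by (simp only: sums_def)
qed

lemma integral_cis_int:
  "integral {-pi..pi} (\<lambda>x. cis (of_int k * x)) = (if k = 0 then of_real (2 * pi) else 0)"
proof (cases "k = 0")
  case False
  have "((\<lambda>x. cis (of_int k * x)) has_integral
      cis (of_int k * pi) / (\<i> * of_int k) - cis (of_int k * - pi) / (\<i> * of_int k)) {-pi..pi}"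
    using False
    by (intro fundamental_theorem_of_calculus)
       (auto intro!: derivative_eq_intros
         simp: has_vector_derivative_def scaleR_conv_of_real fun_eq_iff mult_ac)
  moreover have "cis (of_int k * pi) = cis (of_int k * - pi)"
    by (rule complex_eqI) (auto simp: sin_times_pi_eq_0)
  ultimately show ?thesis using False by (simp add: has_integral_iff)
qed (simp add: scaleR_conv_of_real)

text \<open>
  Split \<open>exp (2 * t * cos x)\<close> as \<open>exp (t * cis x) * exp (t * cis (- x))\<close> and expand the two factors
  one after the other. By orthogonality only one term of the second series survives for each
  term of the first, and the surviving products form the defining series of the Bessel function.
\<close>

lemma bessel_I_integral_nat:
  "((\<lambda>x. exp (2 * t * cos x) * cos (real n * x)) has_integral
      2 * pi * bessel_I_nat n (2 * t)) {-pi..pi}"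
proof -
  have inner: "integral {-pi..pi} (\<lambda>x. exp (of_real t * cis (- x)) * cis (real k * x))
      = of_real (2 * pi * (t ^ k / fact k))" for k
  proof -
    have eq: "(of_real t * cis (- x)) ^ j / fact j * cis (real k * x)
        = of_real (t ^ j / fact j) * cis (of_int (int k - int j) * x)" for j x
      by (simp add: power_mult_distrib Complex.DeMoivre cis_mult algebra_simps)
    have "(\<lambda>j. integral {-pi..pi} (\<lambda>x. (of_real t * cis (- x)) ^ j / fact j * cis (real k * x)))
        sums integral {-pi..pi} (\<lambda>x. exp (of_real t * cis (- x)) * cis (real k * x))"
      by (intro integral_exp_mult_sums continuous_intros)
    then have "(\<lambda>j. if j = k then complex_of_real (2 * pi * (t ^ j / fact j)) else 0)
        sums integral {-pi..pi} (\<lambda>x. exp (of_real t * cis (- x)) * cis (real k * x))"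
      unfolding eq integral_mult_right integral_cis_int
      by (rule back_subst[of "\<lambda>f. f sums _"]) (auto simp: fun_eq_iff)
    from sums_unique2[OF this sums_single] show ?thesis .
  qed
  let ?g = "\<lambda>x. exp (of_real t * cis (- x)) * cis (real n * x)"
  have "(of_real t * cis x) ^ m / fact m * ?g x = of_real (t ^ m / fact m) *
      (exp (of_real t * cis (- x)) * cis (real (m + n) * x))" for m x
    by (simp add: power_mult_distrib Complex.DeMoivre cis_mult algebra_simps)
  moreover have "(\<lambda>m. integral {-pi..pi} (\<lambda>x. (of_real t * cis x) ^ m / fact m * ?g x))
      sums integral {-pi..pi} (\<lambda>x. exp (of_real t * cis x) * ?g x)"
    by (intro integral_exp_mult_sums continuous_intros)
  ultimately have "(\<lambda>m. of_real (t ^ m / fact m) * of_real (2 * pi * (t ^ (m + n) / fact (m + n))))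
      sums integral {-pi..pi} (\<lambda>x. exp (of_real t * cis x) * ?g x)"
    by (simp only: integral_mult_right inner)
  moreover have "complex_of_real (t ^ m / fact m) * of_real (2 * pi * (t ^ (m + n) / fact (m + n)))
      = of_real (2 * pi * (1 / (fact m * Gamma (real m + real n + 1)) * (2 * t / 2) ^ (2 * m + n)))" for m
  proof -
    have "Gamma (real m + real n + 1) = fact (m + n)"
      using Gamma_fact[of "m + n", where 'a = real] by (simp add: add_ac)
    moreover have "t ^ (2 * m + n) = t ^ m * t ^ (m + n)"
      by (simp add: mult_2 add.assoc flip: power_add)
    ultimately show ?thesis
      by (simp only: of_real_mult[symmetric]) simp
  qed
  ultimately have "(\<lambda>m. of_real (2 * pi * (1 / (fact m * Gamma (real m + real n + 1)) *
        (2 * t / 2) ^ (2 * m + n)))) sums integral {-pi..pi} (\<lambda>x. exp (of_real t * cis x) * ?g x)"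
    by (simp only:)
  moreover have "exp (of_real t * cis x) * ?g x = of_real (exp (2 * t * cos x)) * cis (real n * x)" for x
  proof -
    have "of_real t * cis x + of_real t * cis (- x) = of_real (2 * t * cos x)"
      by (simp add: complex_eq_iff)
    then show ?thesis by (simp only: exp_of_real flip: exp_add mult.assoc)
  qed
  ultimately have s: "(\<lambda>m. complex_of_real (2 * pi * (1 / (fact m * Gamma (real m + real n + 1)) *
        (2 * t / 2) ^ (2 * m + n)))) sums
      integral {-pi..pi} (\<lambda>x. of_real (exp (2 * t * cos x)) * cis (real n * x))"
    by simp
  have "((\<lambda>x. of_real (exp (2 * t * cos x)) * cis (real n * x)) has_integral
      integral {-pi..pi} (\<lambda>x. of_real (exp (2 * t * cos x)) * cis (real n * x))) {-pi..pi}"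
    by (intro integrable_integral integrable_continuous_interval continuous_intros)
  from has_integral_linear[OF this bounded_linear_Re]
  have i: "((\<lambda>x. exp (2 * t * cos x) * cos (real n * x)) has_integral
      Re (integral {-pi..pi} (\<lambda>x. of_real (exp (2 * t * cos x)) * cis (real n * x)))) {-pi..pi}"
    by (simp add: o_def)
  have "(\<lambda>m. 2 * pi * (1 / (fact m * Gamma (real m + real n + 1)) * (2 * t / 2) ^ (2 * m + n))) sums
      Re (integral {-pi..pi} (\<lambda>x. of_real (exp (2 * t * cos x)) * cis (real n * x)))"
    using sums_Re[OF s] by (simp only: Re_complex_of_real)
  from sums_divide[OF this, of "2 * pi"]
  have "(\<lambda>m. 1 / (fact m * Gamma (real m + real n + 1)) * (2 * t / 2) ^ (2 * m + n)) sums
      (Re (integral {-pi..pi} (\<lambda>x. of_real (exp (2 * t * cos x)) * cis (real n * x))) / (2 * pi))"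
    by (subst (asm) nonzero_mult_div_cancel_left) simp_all
  then have "2 * pi * bessel_I_nat n (2 * t) =
      Re (integral {-pi..pi} (\<lambda>x. of_real (exp (2 * t * cos x)) * cis (real n * x)))"
    unfolding bessel_I_nat_def by (simp only: sums_iff) simp
  with i show ?thesis by simp
qed

section \<open>Decay of the integral\<close>

lemma power_le_fact_mult_exp:
  fixes x :: real
  assumes "x \<ge> 0"
  shows "x ^ k \<le> fact k * exp x"
proof -
  have "(\<Sum>m\<in>{k}. x ^ m /\<^sub>R fact m) \<le> (\<Sum>m. x ^ m /\<^sub>R fact m)"
    using assms by (intro sum_le_suminf summable_exp_generic) auto
  then show ?thesis by (simp add: exp_def field_simps)
qed

text \<open>
  Trading the exponential for a rational majorant makes the later integral elementary.
\<close>

lemma power_mult_exp_minus_le: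
  fixes x :: real
  assumes "x \<ge> 0"
  shows "x ^ k * exp (- x) \<le> (fact k + fact (Suc k)) / (1 + x)"
proof -
  have "x ^ k * (1 + x) \<le> (fact k + fact (Suc k)) * exp x"
    using power_le_fact_mult_exp[OF assms, of k] power_le_fact_mult_exp[OF assms, of "Suc k"]
    by (simp add: algebra_simps)
  then show ?thesis using assms by (simp add: field_simps exp_minus)
qed

text \<open>
  The function \<open>2 - 2 * cos x = (2 * sin (x / 2))\<^sup>2\<close> is compared with \<open>x\<^sup>2\<close> through the
  quarter angle \<open>y = \<bar>x\<bar> / 4\<close>: there \<open>cos y\<close> stays away from zero, so that
  \<open>sin (2 * y) = 2 * sin y * cos y\<close> and \<open>sin y \<ge> y * cos y\<close> give a bound that remains valid up
  to the end point \<open>\<bar>x\<bar> = pi\<close>.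
\<close>

lemma two_minus_two_cos_ge:
  assumes "\<bar>x\<bar> \<le> pi"
  shows "x\<^sup>2 / 4 \<le> 2 - 2 * cos x"
proof -
  define y where "y = \<bar>x\<bar> / 4"
  have y: "0 \<le> y" "y \<le> pi / 4" using assms by (auto simp: y_def)
  \<comment> \<open>The derivative of \<open>y * cos y - sin y\<close> is \<open>- y * sin y\<close>.\<close>
  have "0 * cos 0 - sin 0 \<ge> y * cos y - sin y"
    by (rule DERIV_nonpos_imp_nonincreasing[where f = "\<lambda>y. y * cos y - sin y"])
       (use y in \<open>auto intro!: exI derivative_eq_intros mult_nonneg_nonneg sin_ge_zero\<close>)
  then have sin: "y * cos y \<le> sin y" by simp
  have cos: "sqrt 2 / 2 \<le> cos y"
    using cos_monotone_0_pi_le[of y "pi/4"] y by (simp add: cos_45)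
  have c2: "1 / 2 \<le> (cos y)\<^sup>2"
    using power_mono[OF cos, of 2] by (simp add: power_divide)
  have "y * (1/2) \<le> y * (cos y)\<^sup>2" using y c2 by (intro mult_left_mono)
  also have "\<dots> \<le> sin y * cos y"
    using mult_right_mono[OF sin, of "cos y"] cos
    by (simp add: power2_eq_square mult_ac order_trans[OF _ cos])
  finally have "y \<le> sin (2 * y)" by (simp add: sin_double)
  then have "y\<^sup>2 \<le> (sin (2 * y))\<^sup>2" using y by (intro power_mono)
  moreover have "cos \<bar>x\<bar> = 1 - 2 * (sin (2 * y))\<^sup>2"
    using cos_double_sin[of "2 * y"] by (simp add: y_def)
  ultimately show ?thesis by (simp add: y_def power_divide)
qed

lemma integral_inverse_one_plus_square_le:
  assumes t: "t > (0::real)"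
  shows "integral {-pi..pi} (\<lambda>x. 1 / (1 + t * (x\<^sup>2 / 4))) \<le> 2 * pi / sqrt t"
proof -
  define F where "F = (\<lambda>x. 2 / sqrt t * arctan (sqrt t / 2 * x))"
  have "((\<lambda>x. 1 / (1 + t * (x\<^sup>2 / 4))) has_integral F pi - F (- pi)) {-pi..pi}"
  proof (rule fundamental_theorem_of_calculus)
    fix x
    have "(F has_real_derivative 2 / sqrt t * (inverse (1 + (sqrt t / 2 * x)\<^sup>2) * (sqrt t / 2)))
        (at x within {-pi..pi})"
      unfolding F_def by (rule derivative_eq_intros refl | simp)+
    also have "2 / sqrt t * (inverse (1 + (sqrt t / 2 * x)\<^sup>2) * (sqrt t / 2))
        = inverse (1 + (sqrt t / 2 * x)\<^sup>2)"
      using t by simp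
    also have "\<dots> = 1 / (1 + t * (x\<^sup>2 / 4))"
      using t by (simp add: power_mult_distrib power_divide inverse_eq_divide)
    finally have "(F has_real_derivative 1 / (1 + t * (x\<^sup>2 / 4))) (at x within {-pi..pi})" .
    then show "(F has_vector_derivative 1 / (1 + t * (x\<^sup>2 / 4))) (at x within {-pi..pi})"
      by (simp add: has_real_derivative_iff_has_vector_derivative)
  qed simp
  moreover have "F pi - F (- pi) = 4 * arctan (sqrt t / 2 * pi) / sqrt t"
    by (simp add: F_def arctan_minus)
  moreover have "\<dots> \<le> 4 * (pi / 2) / sqrt t"
    using t arctan_ubound[of "sqrt t / 2 * pi"] by (intro divide_right_mono) auto
  ultimately show ?thesis by (simp add: has_integral_iff)
qed

section \<open>Size of the symbol of the iterated difference\<close>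

lemma norm_one_minus_cis: "(norm (1 - cis x))\<^sup>2 = 2 - 2 * cos x"
proof -
  have "(norm (1 - cis x))\<^sup>2 = 1 - 2 * cos x + ((cos x)\<^sup>2 + (sin x)\<^sup>2)"
    unfolding cmod_power2 by (simp add: power2_eq_square algebra_simps)
  then show ?thesis by simp
qed

text \<open>
  This is the estimate \<open>\<bar>1 - z ^ m\<bar> \<le> \<bar>m\<bar> * \<bar>1 - z\<bar>\<close> on the unit circle, squared.
\<close>

lemma one_minus_cos_int_mult_le:
  fixes x :: real
  shows "1 - cos (of_int m * x) \<le> (of_int m)\<^sup>2 * (1 - cos x)"
proof -
  have "norm (1 ^ nat \<bar>m\<bar> - cis x ^ nat \<bar>m\<bar>) \<le> real (nat \<bar>m\<bar>) * norm (1 - cis x)"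
    by (rule norm_power_diff) auto
  then have "(norm (1 - cis (\<bar>of_int m\<bar> * x)))\<^sup>2 \<le> (\<bar>of_int m\<bar> * norm (1 - cis x))\<^sup>2"
    by (intro power_mono) (auto simp: Complex.DeMoivre)
  then have "2 - 2 * cos (\<bar>of_int m\<bar> * x) \<le> (of_int m)\<^sup>2 * (2 - 2 * cos x)"
    by (simp only: power_mult_distrib norm_one_minus_cis power2_abs)
  moreover have "cos (\<bar>of_int m\<bar> * x) = cos (of_int m * x)"
    by (simp add: abs_if)
  ultimately show ?thesis by (simp add: algebra_simps)
qed

text \<open>
  On the unit circle \<open>z * (2 - z - 1 / z) = - (1 - z)\<^sup>2\<close>: two forward differences are, up to a
  unimodular factor, one real second difference.
\<close>

lemma one_minus_cis_squared: "(1 - cis x)\<^sup>2 = - of_real (2 - 2 * cos x) * cis x"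
proof -
  have "cis x + cis (- x) = of_real (2 * cos x)" "cis x * cis (- x) = 1"
    by (simp_all add: complex_eq_iff cis_mult)
  then show ?thesis
    unfolding of_real_diff by (simp only: of_real_numeral flip: \<open>_ = of_real (2 * cos x)\<close>) algebra
qed

text \<open>
  For odd \<open>l = 2 * k + 1\<close>, pairing the factors leaves the real factor \<open>(- q) ^ k\<close> and a single
  difference \<open>cos (m * x) - cos ((m + 1) * x)\<close> with \<open>m = n + k\<close>. Both cosines equal 1 up to
  \<open>O(q)\<close>, which supplies the additional factor \<open>q\<close>; the constant grows quadratically in \<open>m\<close>.
\<close>

lemma abs_Re_difference_symbol_le:
  "\<exists>K>0. \<forall>x. \<bar>Re ((1 - cis x) ^ l * cis (of_int n * x))\<bar> \<le> K * (2 - 2 * cos x) ^ ((l + 1) div 2)"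
proof (cases "even l")
  case True
  then obtain k where l: "l = 2 * k" by blast
  have "\<bar>Re ((1 - cis x) ^ l * cis (of_int n * x))\<bar> \<le> 1 * (2 - 2 * cos x) ^ ((l + 1) div 2)" for x
    using abs_Re_le_cmod[of "(1 - cis x) ^ l * cis (of_int n * x)"]
    by (simp add: norm_mult norm_power l power_mult norm_one_minus_cis)
  then show ?thesis by (intro exI[of _ 1]) simp
next
  case False
  then obtain k where l: "l = 2 * k + 1" by (auto elim: oddE)
  define m where "m = n + int k"
  \<comment> \<open>The summand 1 only keeps the constant manifestly positive.\<close>
  define K where "K = (of_int m)\<^sup>2 + (of_int (m + 1))\<^sup>2 + (1::real)"
  have "\<bar>Re ((1 - cis x) ^ l * cis (of_int n * x))\<bar> \<le> K * (2 - 2 * cos x) ^ ((l + 1) div 2)" for x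
  proof -
    define q where "q = 2 - 2 * cos x"
    have q: "q \<ge> 0" by (simp add: q_def)
    have "(1 - cis x) ^ l * cis (of_int n * x)
        = of_real ((- q) ^ k) * (cis x ^ k * cis (of_int n * x) * (1 - cis x))"
      by (simp add: l power_mult one_minus_cis_squared power_mult_distrib q_def)
    also have "cis x ^ k * cis (of_int n * x) = cis (of_int m * x)"
      by (simp add: m_def Complex.DeMoivre cis_mult algebra_simps)
    also have "cis (of_int m * x) * (1 - cis x) = cis (of_int m * x) - cis (of_int (m + 1) * x)"
      by (simp add: cis_mult algebra_simps)
    finally have "\<bar>Re ((1 - cis x) ^ l * cis (of_int n * x))\<bar>
        = q ^ k * \<bar>cos (of_int m * x) - cos (of_int (m + 1) * x)\<bar>"
      using q by (simp add: abs_mult power_abs)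
    also have "\<dots> \<le> q ^ k * (K * q)"
    proof (rule mult_left_mono)
      have "cos (of_int m * x) \<le> 1" "cos (of_int (m + 1) * x) \<le> 1" by simp_all
      then have "\<bar>cos (of_int m * x) - cos (of_int (m + 1) * x)\<bar>
          \<le> (1 - cos (of_int m * x)) + (1 - cos (of_int (m + 1) * x))"
        by linarith
      also have "\<dots> \<le> (of_int m)\<^sup>2 * (1 - cos x) + (of_int (m + 1))\<^sup>2 * (1 - cos x)"
        by (intro add_mono one_minus_cos_int_mult_le)
      also have "\<dots> \<le> K * (1 - cos x)"
        unfolding K_def distrib_right by simp
      also have "\<dots> \<le> K * q"
        by (intro mult_left_mono) (simp_all add: K_def q_def)
      finally show "\<bar>cos (of_int m * x) - cos (of_int (m + 1) * x)\<bar> \<le> K * q" .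
    qed (use q in simp)
    finally show ?thesis by (simp add: l q_def mult_ac)
  qed
  moreover have "K > 0" unfolding K_def by (simp add: add_nonneg_pos)
  ultimately show ?thesis by blast
qed

section \<open>The heat kernel\<close>

text \<open>
  The cosine is even, so the case \<open>l = 0\<close> covers negative orders as well. Since the exponential
  factor does not depend on \<open>n\<close>, differences act on \<open>cis (n * x)\<close> alone, of which each
  \<open>delta_right\<close> splits off a factor \<open>1 - cis x\<close>.
\<close>

lemma delta_right_heat_kernel_integral:
  "((\<lambda>x. exp (- t * (2 - 2 * cos x)) * Re ((1 - cis x) ^ l * cis (of_int n * x))) has_integral
      2 * pi * (delta_right ^^ l) (heat_kernel t) n) {-pi..pi}"
proof (induction l arbitrary: n)
  case 0
  have "((\<lambda>x. exp (- 2 * t) * (exp (2 * t * cos x) * cos (real (nat \<bar>n\<bar>) * x))) has_integral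
      exp (- 2 * t) * (2 * pi * bessel_I_nat (nat \<bar>n\<bar>) (2 * t))) {-pi..pi}"
    by (intro has_integral_mult_right bessel_I_integral_nat)
  moreover have "exp (- 2 * t) * (exp (2 * t * cos x) * cos (real (nat \<bar>n\<bar>) * x))
      = exp (- t * (2 - 2 * cos x)) * cos (of_int n * x)" for x
  proof -
    have "exp (- 2 * t) * exp (2 * t * cos x) = exp (- t * (2 - 2 * cos x))"
      by (simp add: algebra_simps flip: exp_add)
    moreover have "cos (real (nat \<bar>n\<bar>) * x) = cos (of_int n * x)"
      by (simp add: abs_if)
    ultimately show ?thesis by simp
  qed
  ultimately show ?case
    by (simp add: heat_kernel_def bessel_I_def mult_ac)
next
  case (Suc l)
  have "(1 - cis x) ^ Suc l * cis (of_int n * x)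
      = (1 - cis x) ^ l * cis (of_int n * x) - (1 - cis x) ^ l * cis (of_int (n + 1) * x)" for x
  proof -
    have "cis (of_int (n + 1) * x) = cis x * cis (of_int n * x)"
      by (simp add: cis_mult algebra_simps)
    then show ?thesis by (simp add: algebra_simps)
  qed
  then show ?case
    using has_integral_diff[OF Suc.IH[of n] Suc.IH[of "n + 1"]]
    by (simp add: delta_right_def right_diff_distrib)
qed

theorem lemma3:
  fixes l :: nat and n :: int
  shows "\<exists>C>0. \<forall>t>0.
    \<bar>(delta_right ^^ l) (heat_kernel t) n\<bar> \<le> C / t powr (real_of_int \<lfloor>(real l + 1) / 2\<rfloor> + 1 / 2)"
proof -
  define k where "k = (l + 1) div 2"
  define A :: real where "A = fact k + fact (Suc k)"
  have A: "A > 0" by (simp add: A_def add_pos_pos)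
  obtain K where K: "K > 0"
    "\<And>x. \<bar>Re ((1 - cis x) ^ l * cis (of_int n * x))\<bar> \<le> K * (2 - 2 * cos x) ^ k"
    unfolding k_def using abs_Re_difference_symbol_le[of l n] by blast
  have "\<lfloor>(real l + 1) / 2\<rfloor> = int k"
    using floor_divide_of_nat_eq[of "l + 1" 2, where 'a = real] by (simp add: k_def add_ac)
  then have powr: "t powr (real_of_int \<lfloor>(real l + 1) / 2\<rfloor> + 1 / 2) = t ^ k * sqrt t" if "t > 0" for t
    using that by (simp add: powr_add powr_realpow powr_half_sqrt)
  have "\<bar>(delta_right ^^ l) (heat_kernel t) n\<bar> \<le> K * A / (t ^ k * sqrt t)" if t: "t > 0" for t
  proof -
    define f where "f = (\<lambda>x. exp (- t * (2 - 2 * cos x)) * Re ((1 - cis x) ^ l * cis (of_int n * x)))"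
    have int_f: "(f has_integral 2 * pi * (delta_right ^^ l) (heat_kernel t) n) {-pi..pi}"
      unfolding f_def by (rule delta_right_heat_kernel_integral)
    have bound: "\<bar>f x\<bar> \<le> K * A / t ^ k * (1 / (1 + t * (x\<^sup>2 / 4)))" if "x \<in> {-pi..pi}" for x
    proof -
      define q where "q = 2 - 2 * cos x"
      have q: "q \<ge> x\<^sup>2 / 4" "q \<ge> 0"
        using two_minus_two_cos_ge[of x] that by (auto simp: q_def)
      have "\<bar>f x\<bar> \<le> exp (- t * q) * (K * q ^ k)"
        unfolding f_def q_def abs_mult abs_exp_cancel by (intro mult_left_mono K(2)) simp
      also have "\<dots> = K / t ^ k * ((t * q) ^ k * exp (- (t * q)))"
        using t by (simp add: power_mult_distrib)
      also have "\<dots> \<le> K / t ^ k * (A / (1 + t * q))"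
        unfolding A_def using t q K(1) by (intro mult_left_mono power_mult_exp_minus_le) auto
      also have "\<dots> = K * A / t ^ k * (1 / (1 + t * q))"
        by simp
      also have "\<dots> \<le> K * A / t ^ k * (1 / (1 + t * (x\<^sup>2 / 4)))"
        using t q K(1) A
        by (intro mult_left_mono divide_left_mono add_left_mono mult_pos_pos add_pos_nonneg) auto
      finally show ?thesis .
    qed
    have "1 + t * (x\<^sup>2 / 4) \<noteq> 0" for x
      using t add_pos_nonneg[of 1 "t * (x\<^sup>2 / 4)"] by simp
    then have "(\<lambda>x. K * A / t ^ k * (1 / (1 + t * (x\<^sup>2 / 4)))) integrable_on {-pi..pi}"
      by (intro integrable_continuous_interval continuous_intros) auto
    with int_f bound have "norm (integral {-pi..pi} f)
        \<le> integral {-pi..pi} (\<lambda>x. K * A / t ^ k * (1 / (1 + t * (x\<^sup>2 / 4))))"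
      by (intro integral_norm_bound_integral) auto
    also have "\<dots> \<le> K * A / t ^ k * (2 * pi / sqrt t)"
      unfolding integral_mult_right using t K(1) A
      by (intro mult_left_mono integral_inverse_one_plus_square_le) auto
    finally have "2 * pi * \<bar>(delta_right ^^ l) (heat_kernel t) n\<bar> \<le> 2 * pi * (K * A / (t ^ k * sqrt t))"
      using int_f by (simp add: has_integral_iff abs_mult mult_ac)
    then show ?thesis by (simp only: mult_le_cancel_left_pos pi_gt_zero mult_pos_pos zero_less_numeral)
  qed
  with powr have "\<forall>t>0. \<bar>(delta_right ^^ l) (heat_kernel t) n\<bar>
      \<le> K * A / t powr (real_of_int \<lfloor>(real l + 1) / 2\<rfloor> + 1 / 2)"
    by simp
  with K(1) A show ?thesis by (intro exI[of _ "K * A"]) simp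
qed

end
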